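(* Let $(\mathcal{X},\mathcal{A},L)$ be a basic game, let $\Gamma\subseteq\mathcal{P}$ be a family of distributions over $\mathcal{X}$ (not necessarily convex), and let $\zeta_0\in\mathcal{Z}$ be a reference act, with $L(x,\zeta_0)<\infty$ for all $x\in\mathcal X$, such that $L(P,\zeta_0)$ is finite for all $P\in\Gamma$. Let $P^*\in\Gamma$ and $\zeta^*\in\mathcal{Z}$. Suppose $(P^*,\zeta^* )$ is a saddle-point in the relative restricted game $\mathcal{G}_0^\Gamma$. Then for all $P\in\Gamma$, $$D(P,\zeta^* )+D(P^*,\zeta_0)\le D(P,\zeta_0).\qquad( * )$$ Conversely, if $( * )$ holds with its right-hand side finite for all $P\in\Gamma$, then $(P^*,\zeta^* )$ is a saddle-point in $\mathcal{G}_0^\Gamma$.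
   Context: A basic game $(\mathcal{X},\mathcal{A},L)$ consists of measurable spaces $\mathcal{X}$ and $\mathcal{A}$ (with $\sigma$-fields containing all singletons) and a jointly measurable loss function $L:\mathcal{X}\times\mathcal{A}\to(-\infty,\infty]$. Expectations are taken in the extended sense $E f=E f^+-E f^-$, defined unless both terms are infinite. $L(P,a):=E_P\{L(X,a)\}$, and $\mathcal{P}$ is the set of all probability distributions $P$ on $\mathcal{X}$ such that $L(P,a)$ is defined for all $a\in\mathcal{A}$. For a randomized act $\zeta$ (a probability distribution on $\mathcal{A}$), $L(x,\zeta):=E_{A\sim\zeta}\{L(x,A)\}$ and $L(P,\zeta):=E_{(X,A)\sim P\times\zeta}\{L(X,A)\}$; $\mathcal{Z}$ is the set of all $\zeta$ such that $L(P,\zeta)$ is defined for all $P\in\mathcal{P}$. An act $\zeta_P\in\mathcal{Z}$ is Bayes against $P$ if $E_P\{L(X,\zeta)-L(X,\zeta_P)\}\in[0,\infty]$ for all $\zeta\in\mathcal{Z}$. The generalized entropy is $H(P):=\inf_{a\in\mathcal{A}}L(P,a)$. Discrepancy: $D(P,\zeta):=L(P,\zeta)-H(P)\in[0,\infty]$ when $H(P)$ is finite; when $H(P)$ is not finite but $P$ has a Bayes act $\zeta_P$, $D(P,\zeta):=E_P\{L(X,\zeta)-L(X,\zeta_P)\}\in[0,\infty]$. The relative loss is $L_0(P,\zeta):=L(P,\zeta)-L(P,\zeta_0)$ for $P\in\Gamma$, $\zeta\in\mathcal{Z}$, with relative entropy $H_0(P):=\inf_{a\in\mathcal{A}}L_0(P,a)=-D(P,\zeta_0)$;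 in particular $D(P,\zeta_0)=\infty$ when $H_0(P)=-\infty$ (and then the inequality $( * )$ counts as holding trivially). In $\mathcal{G}_0^\Gamma$ Nature chooses $P\in\Gamma$ (no randomization over $\Gamma$), the Decision Maker chooses $\zeta\in\mathcal{Z}$, and the loss is $L_0(P,\zeta)$. The pair $(P^*,\zeta^* )\in\Gamma\times\mathcal{Z}$ is a saddle-point in $\mathcal{G}_0^\Gamma$ if $L_0(P^*,\zeta^* )$ is finite, $L_0(P^*,\zeta^* )\le L_0(P^*,\zeta)$ for all $\zeta\in\mathcal{Z}$, and $L_0(P^*,\zeta^* )\ge L_0(P,\zeta^* )$ for all $P\in\Gamma$. *)

theory Defs
  imports "HOL-Probability.Probability"
begin

text \<open>Extended expectation \<open>E f = E f\<^sup>+ - E f\<^sup>-\<close>. The coercion \<^const>\<open>e2ennreal\<close> truncates negative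
  values to 0, so it yields the positive part. The value of \<open>ext_expect\<close> is meaningful only where
  \<open>expect_defined\<close> holds.\<close>

definition expect_defined :: "'b measure \<Rightarrow> ('b \<Rightarrow> ereal) \<Rightarrow> bool" where
  "expect_defined M f \<longleftrightarrow>
     \<not> ((\<integral>\<^sup>+ x. e2ennreal (f x) \<partial>M) = \<infinity> \<and> (\<integral>\<^sup>+ x. e2ennreal (- f x) \<partial>M) = \<infinity>)"

definition ext_expect :: "'b measure \<Rightarrow> ('b \<Rightarrow> ereal) \<Rightarrow> ereal" where
  "ext_expect M f =
     enn2ereal (\<integral>\<^sup>+ x. e2ennreal (f x) \<partial>M) - enn2ereal (\<integral>\<^sup>+ x. e2ennreal (- f x) \<partial>M)"

text \<open>Only \<^const>\<open>space\<close> and \<^const>\<open>sets\<close> of \<open>X\<close> and \<open>A\<close> are used: they represent measurable spaces.\<close>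

definition basic_game :: "'x measure \<Rightarrow> 'a measure \<Rightarrow> ('x \<Rightarrow> 'a \<Rightarrow> ereal) \<Rightarrow> bool" where
  "basic_game X A L \<longleftrightarrow>
     (\<forall>x\<in>space X. {x} \<in> sets X) \<and>
     (\<forall>a\<in>space A. {a} \<in> sets A) \<and>
     (\<lambda>(x, a). L x a) \<in> borel_measurable (X \<Otimes>\<^sub>M A) \<and>
     (\<forall>x\<in>space X. \<forall>a\<in>space A. L x a \<noteq> -\<infinity>)"

definition loss_Pa :: "('x \<Rightarrow> 'a \<Rightarrow> ereal) \<Rightarrow> 'x measure \<Rightarrow> 'a \<Rightarrow> ereal" where
  "loss_Pa L P a = ext_expect P (\<lambda>x. L x a)"

definition loss_xz :: "('x \<Rightarrow> 'a \<Rightarrow> ereal) \<Rightarrow> 'x \<Rightarrow> 'a measure \<Rightarrow> ereal" where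
  "loss_xz L x \<zeta> = ext_expect \<zeta> (\<lambda>a. L x a)"

definition loss_Pz :: "('x \<Rightarrow> 'a \<Rightarrow> ereal) \<Rightarrow> 'x measure \<Rightarrow> 'a measure \<Rightarrow> ereal" where
  "loss_Pz L P \<zeta> = ext_expect (P \<Otimes>\<^sub>M \<zeta>) (\<lambda>(x, a). L x a)"

text \<open>The family \<open>\<P>\<close>; \<^term>\<open>space (prob_algebra X)\<close> is the set of all probability distributions
  on \<open>X\<close>.\<close>

definition dists :: "'x measure \<Rightarrow> 'a measure \<Rightarrow> ('x \<Rightarrow> 'a \<Rightarrow> ereal) \<Rightarrow> 'x measure set" where
  "dists X A L =
     {P \<in> space (prob_algebra X). \<forall>a\<in>space A. expect_defined P (\<lambda>x. L x a)}"

text \<open>The randomized acts \<open>\<Z>\<close>.\<close>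

definition acts :: "'x measure \<Rightarrow> 'a measure \<Rightarrow> ('x \<Rightarrow> 'a \<Rightarrow> ereal) \<Rightarrow> 'a measure set" where
  "acts X A L =
     {\<zeta> \<in> space (prob_algebra A).
        \<forall>P\<in>dists X A L. expect_defined (P \<Otimes>\<^sub>M \<zeta>) (\<lambda>(x, a). L x a)}"

text \<open>The first conjunct on \<open>\<zeta>\<close> excludes \<open>\<infinity> - \<infinity>\<close> and \<open>-\<infinity> - (-\<infinity>)\<close>, to which \<^typ>\<open>ereal\<close> subtraction
  would assign a value: the integrand must itself be defined almost surely.\<close>

definition bayes_act ::
  "'x measure \<Rightarrow> 'a measure \<Rightarrow> ('x \<Rightarrow> 'a \<Rightarrow> ereal) \<Rightarrow> 'x measure \<Rightarrow> 'a measure \<Rightarrow> bool" where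
  "bayes_act X A L P \<zeta>P \<longleftrightarrow>
     \<zeta>P \<in> acts X A L \<and>
     (\<forall>\<zeta>\<in>acts X A L.
        (AE x in P. \<not> (loss_xz L x \<zeta> = loss_xz L x \<zeta>P \<and> \<bar>loss_xz L x \<zeta>P\<bar> = \<infinity>)) \<and>
        expect_defined P (\<lambda>x. loss_xz L x \<zeta> - loss_xz L x \<zeta>P) \<and>
        0 \<le> ext_expect P (\<lambda>x. loss_xz L x \<zeta> - loss_xz L x \<zeta>P))"

definition gen_entropy :: "'a measure \<Rightarrow> ('x \<Rightarrow> 'a \<Rightarrow> ereal) \<Rightarrow> 'x measure \<Rightarrow> ereal" where
  "gen_entropy A L P = (INF a\<in>space A. loss_Pa L P a)"

text \<open>The last branch covers the distributions for which the discrepancy is otherwise undefined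
  (entropy not finite and no Bayes act). If the loss of a reference act \<open>\<zeta>\<^sub>0\<close> is finite under \<open>P\<close>, then
  non-finite entropy means entropy \<open>-\<infinity>\<close>, equivalently relative entropy \<open>-\<infinity>\<close>, and the discrepancy of
  \<open>P\<close> from \<open>\<zeta>\<^sub>0\<close> is \<open>\<infinity>\<close> by convention; in that situation the Bayes-act branch gives \<open>\<infinity>\<close> too.\<close>

definition discrepancy ::
  "'x measure \<Rightarrow> 'a measure \<Rightarrow> ('x \<Rightarrow> 'a \<Rightarrow> ereal) \<Rightarrow> 'x measure \<Rightarrow> 'a measure \<Rightarrow> ereal" where
  "discrepancy X A L P \<zeta> =
     (if \<bar>gen_entropy A L P\<bar> \<noteq> \<infinity> then loss_Pz L P \<zeta> - gen_entropy A L P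
      else if \<exists>\<zeta>P. bayes_act X A L P \<zeta>P
        then (let \<zeta>P = (SOME \<zeta>P. bayes_act X A L P \<zeta>P)
              in ext_expect P (\<lambda>x. loss_xz L x \<zeta> - loss_xz L x \<zeta>P))
      else \<infinity>)"

text \<open>Used only where the loss of the reference act \<open>\<zeta>\<^sub>0\<close> under \<open>P\<close> is finite.\<close>

definition rel_loss ::
  "('x \<Rightarrow> 'a \<Rightarrow> ereal) \<Rightarrow> 'a measure \<Rightarrow> 'x measure \<Rightarrow> 'a measure \<Rightarrow> ereal" where
  "rel_loss L \<zeta>0 P \<zeta> = loss_Pz L P \<zeta> - loss_Pz L P \<zeta>0"

definition rel_saddle_point ::
  "'x measure \<Rightarrow> 'a measure \<Rightarrow> ('x \<Rightarrow> 'a \<Rightarrow> ereal) \<Rightarrow> 'x measure set \<Rightarrow> 'a measure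
     \<Rightarrow> 'x measure \<Rightarrow> 'a measure \<Rightarrow> bool" where
  "rel_saddle_point X A L \<Gamma> \<zeta>0 Ps \<zeta>s \<longleftrightarrow>
     Ps \<in> \<Gamma> \<and> \<zeta>s \<in> acts X A L \<and>
     \<bar>rel_loss L \<zeta>0 Ps \<zeta>s\<bar> \<noteq> \<infinity> \<and>
     (\<forall>\<zeta>\<in>acts X A L. rel_loss L \<zeta>0 Ps \<zeta>s \<le> rel_loss L \<zeta>0 Ps \<zeta>) \<and>
     (\<forall>P\<in>\<Gamma>. rel_loss L \<zeta>0 P \<zeta>s \<le> rel_loss L \<zeta>0 Ps \<zeta>s)"

end

theory Submission imports Defs begin

text \<open>Point masses are randomized acts, and by Fubini no randomized act beats the entropy. Hence at a
  saddle point \<open>H(P\<^sup>*) = L(P\<^sup>*, \<zeta>\<^sup>*)\<close>, and when \<open>H(P)\<close> and \<open>H(P\<^sup>*)\<close> are finite, adding \<open>H(P)\<close> to both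
  sides turns the inequality of discrepancies into \<open>L\<^sub>0(P, \<zeta>\<^sup>*) \<le> L\<^sub>0(P\<^sup>*, \<zeta>\<^sup>*)\<close>. The only other
  possibility is \<open>H(P) = -\<infinity>\<close>, where \<open>D(P, \<zeta>\<^sub>0) = \<infinity>\<close>: if \<open>\<zeta>\<^sub>P\<close> is Bayes and
  \<open>E\<^sub>P{L(X, \<zeta>\<^sub>0) - L(X, \<zeta>\<^sub>P)}\<close> were finite, then \<open>L(X, \<zeta>\<^sub>P)\<close> would be integrable, and its
  expectation would be a finite lower bound for \<open>L(P, a)\<close> over all \<open>a\<close>.\<close>

section \<open>Positive and negative parts of extended expectations\<close>

text \<open>Positive and negative parts are balanced across the two sides because subtraction on
  \<^typ>\<open>ennreal\<close> truncates. No definedness hypothesis appears since \<open>\<infinity> - \<infinity> = \<infinity>\<close> in \<^typ>\<open>ereal\<close>.\<close>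

lemma ereal_le_enn2ereal_diff_iff:
  "ereal c \<le> enn2ereal p - enn2ereal q \<longleftrightarrow> ennreal c + q \<le> p + ennreal (- c)"
  by (cases p; cases q; cases "0 \<le> c")
    (auto simp flip: ennreal_plus simp: ennreal_neg top_add top_unique)

lemma ereal_le_ext_expect_iff:
  "ereal c \<le> ext_expect M f \<longleftrightarrow>
     ennreal c + (\<integral>\<^sup>+ x. e2ennreal (- f x) \<partial>M) \<le> (\<integral>\<^sup>+ x. e2ennreal (f x) \<partial>M) + ennreal (- c)"
  unfolding ext_expect_def by (rule ereal_le_enn2ereal_diff_iff)

text \<open>Pointwise decomposition into parts; it evaluates an extended expectation under a point
  mass.\<close>

lemma enn2ereal_e2ennreal_diff: "enn2ereal (e2ennreal z) - enn2ereal (e2ennreal (- z)) = z"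
  by (cases "0 \<le> z"; cases z) (simp_all add: e2ennreal_neg ennreal_neg zero_ennreal.rep_eq)

text \<open>An infinite part never cancels: \<infinity> - \<infinity> = \<infinity> in
  \<open>ereal\<close>.\<close>

lemma ext_expect_finiteD:
  assumes "\<bar>ext_expect M f\<bar> \<noteq> \<infinity>"
  shows "(\<integral>\<^sup>+ x. e2ennreal (f x) \<partial>M) \<noteq> \<infinity>" and "(\<integral>\<^sup>+ x. e2ennreal (- f x) \<partial>M) \<noteq> \<infinity>"
  using assms unfolding ext_expect_def
  by (cases "\<integral>\<^sup>+ x. e2ennreal (f x) \<partial>M"; cases "\<integral>\<^sup>+ x. e2ennreal (- f x) \<partial>M"; simp)+

lemma e2ennreal_eq_infinityD: "e2ennreal z \<noteq> \<infinity> \<Longrightarrow> e2ennreal (- z) \<noteq> \<infinity> \<Longrightarrow> \<bar>z\<bar> \<noteq> \<infinity>"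
  by (cases z) auto

lemma AE_finite_if_nn_integral_finite:
  assumes [measurable]: "f \<in> borel_measurable M"
    and "(\<integral>\<^sup>+ x. e2ennreal (f x) \<partial>M) \<noteq> \<infinity>" "(\<integral>\<^sup>+ x. e2ennreal (- f x) \<partial>M) \<noteq> \<infinity>"
  shows "AE x in M. \<bar>f x\<bar> \<noteq> \<infinity>"
proof -
  have "AE x in M. e2ennreal (f x) \<noteq> \<infinity>" "AE x in M. e2ennreal (- f x) \<noteq> \<infinity>"
    by (rule nn_integral_PInf_AE; use assms in simp)+
  then show ?thesis
    by eventually_elim (rule e2ennreal_eq_infinityD)
qed

text \<open>Every part stands on the side where it is added, so the identity can be integrated term
  by term in \<open>ennreal\<close> and survives infinite \<open>g\<close>.\<close>

lemma e2ennreal_diff_balance: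
  assumes "\<bar>v\<bar> \<noteq> \<infinity>"
  shows "e2ennreal (g - v) + (e2ennreal v + e2ennreal (- g))
       = e2ennreal (- (g - v)) + (e2ennreal (- v) + e2ennreal g)"
proof (cases v)
  case v: (real r)
  show ?thesis
  proof (cases g)
    case g: (real s)
    show ?thesis
      unfolding v g
      by (cases "0 \<le> r"; cases "0 \<le> s"; cases "r \<le> s")
        (simp_all flip: ennreal_plus add: ennreal_neg)
  qed (simp_all add: v top_add)
qed (use assms in auto)

text \<open>With \<open>p\<close> and \<open>q\<close> the integrals of the two parts of the loss
  over acts, this bounds the parts of the averaged loss by the averages of the parts.\<close>

lemma e2ennreal_enn2ereal_diff_le:
  "e2ennreal (enn2ereal p - enn2ereal q) \<le> p"
  "e2ennreal (- (enn2ereal p - enn2ereal q)) \<le> q"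
  by (cases p; cases q; simp add: e2ennreal_neg ennreal_leI)+

text \<open>Since \<open>g\<close> may fail to be integrable, the balance identity is integrated in
  place of linearity, and the negative part of the difference is cancelled.\<close>

lemma ext_expect_le_if_diff_nonneg:
  assumes [measurable]: "g \<in> borel_measurable M" "v \<in> borel_measurable M"
    and v_pos: "(\<integral>\<^sup>+ x. e2ennreal (v x) \<partial>M) \<noteq> \<infinity>"
    and v_neg: "(\<integral>\<^sup>+ x. e2ennreal (- v x) \<partial>M) \<noteq> \<infinity>"
    and dfd: "expect_defined M (\<lambda>x. g x - v x)"
    and nonneg: "0 \<le> ext_expect M (\<lambda>x. g x - v x)"
  shows "ext_expect M v \<le> ext_expect M g"
proof -
  let ?Ip = "\<integral>\<^sup>+ x. e2ennreal (g x - v x) \<partial>M" and ?In = "\<integral>\<^sup>+ x. e2ennreal (- (g x - v x)) \<partial>M"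
  let ?Vp = "\<integral>\<^sup>+ x. e2ennreal (v x) \<partial>M" and ?Vn = "\<integral>\<^sup>+ x. e2ennreal (- v x) \<partial>M"
  let ?Gp = "\<integral>\<^sup>+ x. e2ennreal (g x) \<partial>M" and ?Gn = "\<integral>\<^sup>+ x. e2ennreal (- g x) \<partial>M"
  have le: "?In \<le> ?Ip"
    using nonneg ereal_le_ext_expect_iff[of 0 M "\<lambda>x. g x - v x"] by (simp add: zero_ereal_def)
  \<comment> \<open>Definedness forbids two infinite parts, so the smaller one is finite.\<close>
  then have fin: "?In \<noteq> \<infinity>"
    using dfd unfolding expect_defined_def by (auto simp: top_unique)
  have "AE x in M. \<bar>v x\<bar> \<noteq> \<infinity>"
    by (intro AE_finite_if_nn_integral_finite v_pos v_neg) measurable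
  then have "AE x in M. e2ennreal (g x - v x) + (e2ennreal (v x) + e2ennreal (- g x))
       = e2ennreal (- (g x - v x)) + (e2ennreal (- v x) + e2ennreal (g x))"
    by eventually_elim (rule e2ennreal_diff_balance)
  then have "(\<integral>\<^sup>+ x. e2ennreal (g x - v x) + (e2ennreal (v x) + e2ennreal (- g x)) \<partial>M)
      = (\<integral>\<^sup>+ x. e2ennreal (- (g x - v x)) + (e2ennreal (- v x) + e2ennreal (g x)) \<partial>M)"
    by (rule nn_integral_cong_AE)
  then have "?Ip + (?Vp + ?Gn) = ?In + (?Vn + ?Gp)"
    by (simp add: nn_integral_add)
  then have "?In + (?Vp + ?Gn) \<le> ?In + (?Vn + ?Gp)"
    using le by (metis add_right_mono)
  then have "?Vp + ?Gn \<le> ?Vn + ?Gp"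
    using fin by (simp add: ennreal_add_left_cancel_le)
  \<comment> \<open>If \<open>?Gn\<close> is infinite, so is \<open>?Gp\<close>, and the expectation
    of \<open>g\<close> then takes the value \<infinity>.\<close>
  then show ?thesis
    using v_pos v_neg unfolding ext_expect_def
    by (cases ?Vp; cases ?Vn; cases ?Gp; cases ?Gn)
      (auto simp flip: ennreal_plus simp: top_unique top_add)
qed

text \<open>Write v = u - (u - v): almost everywhere, each part of \<open>v\<close> is at most the
  same part of \<open>u\<close> plus the opposite part of \<open>u - v\<close>.\<close>

lemma positive_parts_finite_of_diff:
  assumes [measurable]: "u \<in> borel_measurable M" "v \<in> borel_measurable M"
    and "(\<integral>\<^sup>+ x. e2ennreal (u x) \<partial>M) \<noteq> \<infinity>" "(\<integral>\<^sup>+ x. e2ennreal (- u x) \<partial>M) \<noteq> \<infinity>"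
    and "(\<integral>\<^sup>+ x. e2ennreal (u x - v x) \<partial>M) \<noteq> \<infinity>" "(\<integral>\<^sup>+ x. e2ennreal (- (u x - v x)) \<partial>M) \<noteq> \<infinity>"
  shows "(\<integral>\<^sup>+ x. e2ennreal (v x) \<partial>M) \<noteq> \<infinity>" and "(\<integral>\<^sup>+ x. e2ennreal (- v x) \<partial>M) \<noteq> \<infinity>"
proof -
  have bound: "e2ennreal (v x) \<le> e2ennreal (u x) + e2ennreal (- (u x - v x)) \<and>
      e2ennreal (- v x) \<le> e2ennreal (- u x) + e2ennreal (u x - v x)"
    if "\<bar>u x\<bar> \<noteq> \<infinity>" "\<bar>u x - v x\<bar> \<noteq> \<infinity>" for x
  proof (cases "u x"; cases "v x")
    fix r s assume "u x = ereal r" "v x = ereal s"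
    then show ?thesis
      by (cases "0 \<le> r"; cases "0 \<le> s"; cases "r \<le> s")
        (simp_all flip: ennreal_plus add: ennreal_neg ennreal_leI)
  qed (use that in auto)
  have "AE x in M. \<bar>u x\<bar> \<noteq> \<infinity>" "AE x in M. \<bar>u x - v x\<bar> \<noteq> \<infinity>"
    by (intro AE_finite_if_nn_integral_finite assms; measurable)+
  then have "AE x in M. e2ennreal (v x) \<le> e2ennreal (u x) + e2ennreal (- (u x - v x)) \<and>
      e2ennreal (- v x) \<le> e2ennreal (- u x) + e2ennreal (u x - v x)"
    by eventually_elim (rule bound)
  then have "(\<integral>\<^sup>+ x. e2ennreal (v x) \<partial>M)
        \<le> (\<integral>\<^sup>+ x. e2ennreal (u x) + e2ennreal (- (u x - v x)) \<partial>M)"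
      "(\<integral>\<^sup>+ x. e2ennreal (- v x) \<partial>M) \<le> (\<integral>\<^sup>+ x. e2ennreal (- u x) + e2ennreal (u x - v x) \<partial>M)"
    by (auto intro!: nn_integral_mono_AE)
  then show "(\<integral>\<^sup>+ x. e2ennreal (v x) \<partial>M) \<noteq> \<infinity>" "(\<integral>\<^sup>+ x. e2ennreal (- v x) \<partial>M) \<noteq> \<infinity>"
    using assms by (auto simp: nn_integral_add top_unique)
qed

section \<open>Point masses as randomized acts\<close>

lemma prob_algebraD:
  assumes "M \<in> space (prob_algebra N)"
  shows "prob_space M" "sets M = sets N" "space M = space N"
  using assms by (auto simp: space_prob_algebra dest: sets_eq_imp_space_eq)

locale game =
  fixes X :: "'x measure" and A :: "'a measure" and L :: "'x \<Rightarrow> 'a \<Rightarrow> ereal"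
  assumes basic_game: "basic_game X A L"
begin

lemma measurable_L:
  assumes "sets P = sets X" "sets \<zeta> = sets A"
  shows "(\<lambda>(x, a). L x a) \<in> borel_measurable (P \<Otimes>\<^sub>M \<zeta>)"
  using basic_game unfolding basic_game_def
  by (simp cong: measurable_cong_sets add: sets_pair_measure_cong[OF assms])

lemma measurable_L_snd:
  assumes "sets \<zeta> = sets A" "x \<in> space X"
  shows "(\<lambda>a. L x a) \<in> borel_measurable \<zeta>"
  using measurable_compose[OF measurable_Pair1'[of x X \<zeta>] measurable_L[OF refl assms(1)]] assms(2)
  by simp

text \<open>Tonelli and evaluation at the point mass; a general \<open>h\<close> treats both parts
  of the loss alike.\<close>

lemma nn_integral_loss_return:
  assumes P: "P \<in> space (prob_algebra X)" and a: "a \<in> space A"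
    and [measurable]: "h \<in> borel_measurable borel"
  shows "(\<integral>\<^sup>+ z. h (case z of (x, a) \<Rightarrow> L x a) \<partial>(P \<Otimes>\<^sub>M return A a)) = (\<integral>\<^sup>+ x. h (L x a) \<partial>P)"
proof -
  note P = prob_algebraD[OF P]
  interpret R: prob_space "return A a"
    using a by (rule prob_space_return)
  have [measurable]: "(\<lambda>(x, a). L x a) \<in> borel_measurable (P \<Otimes>\<^sub>M return A a)"
    using P by (intro measurable_L) auto
  have "(\<integral>\<^sup>+ z. h (case z of (x, a) \<Rightarrow> L x a) \<partial>(P \<Otimes>\<^sub>M return A a))
      = (\<integral>\<^sup>+ x. \<integral>\<^sup>+ b. h (L x b) \<partial>return A a \<partial>P)"
    by (subst R.nn_integral_fst[symmetric]) auto
  also have "\<dots> = (\<integral>\<^sup>+ x. h (L x a) \<partial>P)"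
    using measurable_L_snd[OF refl] a P
    by (intro nn_integral_cong) (auto intro!: nn_integral_return measurable_compose[OF _ assms(3)])
  finally show ?thesis .
qed

lemma loss_Pz_return:
  assumes "P \<in> space (prob_algebra X)" "a \<in> space A"
  shows "loss_Pz L P (return A a) = loss_Pa L P a"
  using nn_integral_loss_return[OF assms, of e2ennreal]
    nn_integral_loss_return[OF assms, of "\<lambda>y. e2ennreal (- y)"]
  by (simp add: loss_Pz_def loss_Pa_def ext_expect_def)

text \<open>Both parts of the loss transfer from the product to \<open>P\<close>, so definedness
  becomes the condition at \<open>a\<close> in \<open>dists\<close>.\<close>

lemma return_in_acts:
  assumes "a \<in> space A"
  shows "return A a \<in> acts X A L"
  using assms nn_integral_loss_return[of _ a e2ennreal]
    nn_integral_loss_return[of _ a "\<lambda>y. e2ennreal (- y)"]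
  by (auto simp: acts_def dists_def expect_defined_def space_prob_algebra prob_space_return)

lemma loss_xz_return:
  assumes "a \<in> space A" "x \<in> space X"
  shows "loss_xz L x (return A a) = L x a"
proof -
  note [measurable] = measurable_L_snd[OF refl assms(2)]
  show ?thesis
    using assms(1) enn2ereal_e2ennreal_diff[of "L x a"] unfolding loss_xz_def ext_expect_def
    by (simp add: nn_integral_return)
qed

section \<open>The entropy as a lower bound over randomized acts\<close>

text \<open>A real lower bound common to all \<open>loss_Pa L P a\<close>, written with sums of
  parts only, is averaged over \<open>\<zeta>\<close>, and the order of integration is
  exchanged.\<close>

lemma gen_entropy_le_loss_Pz:
  assumes "P \<in> dists X A L" "\<zeta> \<in> acts X A L"
  shows "gen_entropy A L P \<le> loss_Pz L P \<zeta>"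
\<comment> \<open>This avoids cases on the entropy: any \<open>d\<close> strictly below it is real
  or -\<infinity>, and the latter is trivial.\<close>
proof (rule dense_le)
  have Pp: "P \<in> space (prob_algebra X)" and \<zeta>p: "\<zeta> \<in> space (prob_algebra A)"
    using assms by (auto simp: dists_def acts_def)
  note P = prob_algebraD[OF Pp] and Z = prob_algebraD[OF \<zeta>p]
  interpret P: prob_space P by (rule P)
  interpret \<zeta>: prob_space \<zeta> by (rule Z)
  interpret pair_sigma_finite P \<zeta> ..
  note [measurable] = measurable_L[OF P(2) Z(2)]
  fix d assume d: "d < gen_entropy A L P"
  show "d \<le> loss_Pz L P \<zeta>"
  proof (cases d)
    case (real c)
    have "ennreal c + (\<integral>\<^sup>+ x. e2ennreal (- L x a) \<partial>P) \<le> (\<integral>\<^sup>+ x. e2ennreal (L x a) \<partial>P) + ennreal (- c)"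
      if "a \<in> space A" for a
    proof -
      have "ereal c \<le> ext_expect P (\<lambda>x. L x a)"
        using d INF_lower[OF that, of "loss_Pa L P"] unfolding real gen_entropy_def loss_Pa_def
        by (meson less_imp_le order_trans)
      then show ?thesis
        by (simp add: ereal_le_ext_expect_iff)
    qed
    then have "(\<integral>\<^sup>+ a. ennreal c + (\<integral>\<^sup>+ x. e2ennreal (- L x a) \<partial>P) \<partial>\<zeta>)
        \<le> (\<integral>\<^sup>+ a. (\<integral>\<^sup>+ x. e2ennreal (L x a) \<partial>P) + ennreal (- c) \<partial>\<zeta>)"
      using Z by (intro nn_integral_mono) auto
    also have "(\<integral>\<^sup>+ a. ennreal c + (\<integral>\<^sup>+ x. e2ennreal (- L x a) \<partial>P) \<partial>\<zeta>)
        = ennreal c + (\<integral>\<^sup>+ a. \<integral>\<^sup>+ x. e2ennreal (- L x a) \<partial>P \<partial>\<zeta>)"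
      by (simp add: nn_integral_add \<zeta>.emeasure_space_1)
    also have "(\<integral>\<^sup>+ a. (\<integral>\<^sup>+ x. e2ennreal (L x a) \<partial>P) + ennreal (- c) \<partial>\<zeta>)
        = (\<integral>\<^sup>+ a. \<integral>\<^sup>+ x. e2ennreal (L x a) \<partial>P \<partial>\<zeta>) + ennreal (- c)"
      by (simp add: nn_integral_add \<zeta>.emeasure_space_1)
    finally show ?thesis
      unfolding real loss_Pz_def ereal_le_ext_expect_iff
      by (simp add: nn_integral_snd[symmetric] case_prod_unfold)
  qed (use d in auto)
qed

section \<open>Infinite discrepancy from the reference act\<close>

lemma measurable_loss_xz:
  assumes "P \<in> space (prob_algebra X)" "\<zeta> \<in> space (prob_algebra A)"
  shows "(\<lambda>x. loss_xz L x \<zeta>) \<in> borel_measurable P"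
proof -
  note P = prob_algebraD[OF assms(1)] and Z = prob_algebraD[OF assms(2)]
  interpret \<zeta>: prob_space \<zeta> by (rule Z)
  note [measurable] = measurable_L[OF P(2) Z(2)]
  show ?thesis
    unfolding loss_xz_def ext_expect_def by measurable
qed

text \<open>The averages of the parts dominate the parts of the averaged loss, and by Tonelli they
  are the two finite parts of \<open>loss_Pz L P \<zeta>\<close>.\<close>

lemma loss_xz_parts_finite:
  assumes "P \<in> space (prob_algebra X)" "\<zeta> \<in> space (prob_algebra A)"
    and "\<bar>loss_Pz L P \<zeta>\<bar> \<noteq> \<infinity>"
  shows "(\<integral>\<^sup>+ x. e2ennreal (loss_xz L x \<zeta>) \<partial>P) \<noteq> \<infinity>"
    and "(\<integral>\<^sup>+ x. e2ennreal (- loss_xz L x \<zeta>) \<partial>P) \<noteq> \<infinity>"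
proof -
  note P = prob_algebraD[OF assms(1)] and Z = prob_algebraD[OF assms(2)]
  interpret \<zeta>: prob_space \<zeta> by (rule Z)
  note [measurable] = measurable_L[OF P(2) Z(2)]
  note fin = ext_expect_finiteD[OF assms(3)[unfolded loss_Pz_def]]
  have "(\<integral>\<^sup>+ x. e2ennreal (loss_xz L x \<zeta>) \<partial>P) \<le> (\<integral>\<^sup>+ x. \<integral>\<^sup>+ a. e2ennreal (L x a) \<partial>\<zeta> \<partial>P)"
    unfolding loss_xz_def ext_expect_def
    by (intro nn_integral_mono e2ennreal_enn2ereal_diff_le)
  also have "\<dots> = (\<integral>\<^sup>+ z. e2ennreal (case z of (x, a) \<Rightarrow> L x a) \<partial>(P \<Otimes>\<^sub>M \<zeta>))"
    by (subst \<zeta>.nn_integral_fst[symmetric]) auto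
  finally show "(\<integral>\<^sup>+ x. e2ennreal (loss_xz L x \<zeta>) \<partial>P) \<noteq> \<infinity>"
    using fin(1) by (auto simp: top_unique)
  have "(\<integral>\<^sup>+ x. e2ennreal (- loss_xz L x \<zeta>) \<partial>P) \<le> (\<integral>\<^sup>+ x. \<integral>\<^sup>+ a. e2ennreal (- L x a) \<partial>\<zeta> \<partial>P)"
    unfolding loss_xz_def ext_expect_def
    by (intro nn_integral_mono e2ennreal_enn2ereal_diff_le)
  also have "\<dots> = (\<integral>\<^sup>+ z. e2ennreal (- (case z of (x, a) \<Rightarrow> L x a)) \<partial>(P \<Otimes>\<^sub>M \<zeta>))"
    by (subst \<zeta>.nn_integral_fst[symmetric]) auto
  finally show "(\<integral>\<^sup>+ x. e2ennreal (- loss_xz L x \<zeta>) \<partial>P) \<noteq> \<infinity>"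
    using fin(2) by (auto simp: top_unique)
qed

text \<open>Makes the Bayes-act branch of \<open>discrepancy\<close> agree with the default
  \<infinity> at \<open>\<zeta>0\<close>.\<close>

lemma ext_expect_bayes_diff_infinite:
  assumes P: "P \<in> dists X A L" and \<zeta>0: "\<zeta>0 \<in> acts X A L"
    and fin: "\<bar>loss_Pz L P \<zeta>0\<bar> \<noteq> \<infinity>"
    and H: "gen_entropy A L P = -\<infinity>"
    and bayes: "bayes_act X A L P \<zeta>P"
  shows "ext_expect P (\<lambda>x. loss_xz L x \<zeta>0 - loss_xz L x \<zeta>P) = \<infinity>" (is "ext_expect P ?w = \<infinity>")
proof (rule ccontr)
  assume neq: "ext_expect P ?w \<noteq> \<infinity>"
  have Pp: "P \<in> space (prob_algebra X)" and \<zeta>0p: "\<zeta>0 \<in> space (prob_algebra A)"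
    and \<zeta>Pp: "\<zeta>P \<in> space (prob_algebra A)"
    using P \<zeta>0 bayes by (auto simp: dists_def acts_def bayes_act_def)
  have "0 \<le> ext_expect P ?w"
    using bayes \<zeta>0 by (auto simp: bayes_act_def)
  then have "\<bar>ext_expect P ?w\<bar> \<noteq> \<infinity>"
    using neq by auto
  note v_fin = positive_parts_finite_of_diff[OF measurable_loss_xz[OF Pp \<zeta>0p]
      measurable_loss_xz[OF Pp \<zeta>Pp] loss_xz_parts_finite[OF Pp \<zeta>0p fin]
      ext_expect_finiteD[OF this]]
  let ?V = "ext_expect P (\<lambda>x. loss_xz L x \<zeta>P)"
  \<comment> \<open>Each point mass competes with the Bayes act, so the bound is uniform in
    \<open>a\<close>.\<close>
  have "?V \<le> loss_Pa L P a" if a: "a \<in> space A" for a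
  proof -
    have "expect_defined P (\<lambda>x. loss_xz L x (return A a) - loss_xz L x \<zeta>P)"
        "0 \<le> ext_expect P (\<lambda>x. loss_xz L x (return A a) - loss_xz L x \<zeta>P)"
      using bayes return_in_acts[OF a] by (auto simp: bayes_act_def)
    moreover have "return A a \<in> space (prob_algebra A)"
      using return_in_acts[OF a] by (simp add: acts_def)
    ultimately have "?V \<le> ext_expect P (\<lambda>x. loss_xz L x (return A a))"
      using v_fin by (intro ext_expect_le_if_diff_nonneg measurable_loss_xz Pp \<zeta>Pp)
    also have "\<dots> = loss_Pa L P a"
      using a prob_algebraD[OF Pp] unfolding loss_Pa_def ext_expect_def
      by (simp add: loss_xz_return cong: nn_integral_cong_simp)
    finally show ?thesis .
  qed
  then have "?V \<le> gen_entropy A L P"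
    unfolding gen_entropy_def by (rule INF_greatest)
  moreover have "?V \<noteq> -\<infinity>"
    using v_fin unfolding ext_expect_def
    by (cases "\<integral>\<^sup>+ x. e2ennreal (loss_xz L x \<zeta>P) \<partial>P";
        cases "\<integral>\<^sup>+ x. e2ennreal (- loss_xz L x \<zeta>P) \<partial>P") auto
  ultimately show False
    using H by simp
qed

lemma discrepancy_eq_infinity:
  assumes "P \<in> dists X A L" "\<zeta>0 \<in> acts X A L"
    and "\<bar>loss_Pz L P \<zeta>0\<bar> \<noteq> \<infinity>" "\<bar>gen_entropy A L P\<bar> = \<infinity>"
  shows "discrepancy X A L P \<zeta>0 = \<infinity>"
proof -
  \<comment> \<open>The finite loss of \<open>\<zeta>0\<close> bounds the entropy above, which
    excludes +\<infinity>.\<close>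
  have "gen_entropy A L P = -\<infinity>"
    using gen_entropy_le_loss_Pz[OF assms(1,2)] assms(3,4) by auto
  note * = ext_expect_bayes_diff_infinite[OF assms(1-3) this]
  \<comment> \<open>Every Bayes act gives \<infinity>, so the choice made by \<open>SOME\<close> is
    immaterial.\<close>
  show ?thesis
    unfolding discrepancy_def Let_def using assms(4) by (auto intro: * someI)
qed

end

section \<open>Saddle points and the inequality of discrepancies\<close>

theorem theorem10p1:
  fixes X :: "'x measure" and A :: "'a measure" and L :: "'x \<Rightarrow> 'a \<Rightarrow> ereal"
    and \<Gamma> :: "'x measure set" and \<zeta>0 \<zeta>s :: "'a measure" and Ps :: "'x measure"
  assumes "basic_game X A L"
    and "\<Gamma> \<subseteq> dists X A L"
    and "\<zeta>0 \<in> acts X A L"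
    and "\<And>x. x \<in> space X \<Longrightarrow> loss_xz L x \<zeta>0 < \<infinity>"
    and "\<And>P. P \<in> \<Gamma> \<Longrightarrow> \<bar>loss_Pz L P \<zeta>0\<bar> \<noteq> \<infinity>"
    and "Ps \<in> \<Gamma>"
    and "\<zeta>s \<in> acts X A L"
  shows "(rel_saddle_point X A L \<Gamma> \<zeta>0 Ps \<zeta>s \<longrightarrow>
            (\<forall>P\<in>\<Gamma>. discrepancy X A L P \<zeta>s + discrepancy X A L Ps \<zeta>0 \<le> discrepancy X A L P \<zeta>0))
       \<and> ((\<forall>P\<in>\<Gamma>. discrepancy X A L P \<zeta>s + discrepancy X A L Ps \<zeta>0 \<le> discrepancy X A L P \<zeta>0
               \<and> \<bar>discrepancy X A L P \<zeta>0\<bar> \<noteq> \<infinity>) \<longrightarrow>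
            rel_saddle_point X A L \<Gamma> \<zeta>0 Ps \<zeta>s)"
proof -
  interpret game X A L
    by standard fact
  note fin0 = assms(5)
  have dist: "P \<in> dists X A L" if "P \<in> \<Gamma>" for P
    using assms(2) that by auto
  have discr: "discrepancy X A L P \<zeta> = loss_Pz L P \<zeta> - gen_entropy A L P"
    if "\<bar>gen_entropy A L P\<bar> \<noteq> \<infinity>" for P \<zeta>
    using that by (simp add: discrepancy_def)
  show ?thesis
  proof (intro conjI impI ballI)
    fix P assume saddle: "rel_saddle_point X A L \<Gamma> \<zeta>0 Ps \<zeta>s" and P: "P \<in> \<Gamma>"
    let ?l = "loss_Pz L" and ?H = "gen_entropy A L"
    have sfin: "\<bar>?l Ps \<zeta>s\<bar> \<noteq> \<infinity>"
      using saddle fin0[OF \<open>Ps \<in> \<Gamma>\<close>] unfolding rel_saddle_point_def rel_loss_def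
      by (cases "?l Ps \<zeta>s") auto
    \<comment> \<open>Optimality at \<open>Ps\<close> is tested against point masses, and the finite
      reference loss is cancelled.\<close>
    have "?l Ps \<zeta>s \<le> loss_Pa L Ps a" if a: "a \<in> space A" for a
    proof -
      have "?l Ps \<zeta>s - ?l Ps \<zeta>0 \<le> ?l Ps (return A a) - ?l Ps \<zeta>0"
        using saddle return_in_acts[OF a] by (simp add: rel_saddle_point_def rel_loss_def)
      then have "?l Ps \<zeta>s \<le> ?l Ps (return A a)"
        using fin0[OF \<open>Ps \<in> \<Gamma>\<close>]
        by (cases "?l Ps \<zeta>s"; cases "?l Ps (return A a)"; cases "?l Ps \<zeta>0") auto
      also have "\<dots> = loss_Pa L Ps a"
        using dist[OF \<open>Ps \<in> \<Gamma>\<close>] a by (intro loss_Pz_return) (auto simp: dists_def)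
      finally show ?thesis .
    qed
    then have "?l Ps \<zeta>s \<le> ?H Ps"
      unfolding gen_entropy_def by (rule INF_greatest)
    then have Hs: "?H Ps = ?l Ps \<zeta>s"
      using gen_entropy_le_loss_Pz[OF dist assms(7)] \<open>Ps \<in> \<Gamma>\<close> by (auto intro: antisym)
    have le: "?l P \<zeta>s - ?l P \<zeta>0 \<le> ?l Ps \<zeta>s - ?l Ps \<zeta>0"
      using saddle P by (simp add: rel_saddle_point_def rel_loss_def)
    show "discrepancy X A L P \<zeta>s + discrepancy X A L Ps \<zeta>0 \<le> discrepancy X A L P \<zeta>0"
    proof (cases "\<bar>?H P\<bar> = \<infinity>")
      case True
      then show ?thesis
        using discrepancy_eq_infinity[OF dist assms(3) fin0] P by simp
    next
      case False
      \<comment> \<open>By \<open>Hs\<close>, the discrepancy of \<open>Ps\<close> from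
        \<open>\<zeta>0\<close> is minus the saddle value, so subtracting the finite
        \<open>?H P\<close> in \<open>le\<close> gives the claim.\<close>
      then show ?thesis
        using le sfin fin0[OF P] fin0[OF \<open>Ps \<in> \<Gamma>\<close>] discr[OF False] discr[of Ps] Hs
        by (cases "?l P \<zeta>s"; cases "?l Ps \<zeta>s"; cases "?l P \<zeta>0"; cases "?l Ps \<zeta>0"; cases "?H P") auto
    qed
  next
    let ?l = "loss_Pz L" and ?H = "gen_entropy A L"
    assume "\<forall>P\<in>\<Gamma>. discrepancy X A L P \<zeta>s + discrepancy X A L Ps \<zeta>0 \<le> discrepancy X A L P \<zeta>0
               \<and> \<bar>discrepancy X A L P \<zeta>0\<bar> \<noteq> \<infinity>"
    then have ineq: "discrepancy X A L P \<zeta>s + discrepancy X A L Ps \<zeta>0 \<le> discrepancy X A L P \<zeta>0"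
      and dfin: "\<bar>discrepancy X A L P \<zeta>0\<bar> \<noteq> \<infinity>" if "P \<in> \<Gamma>" for P
      using that by auto
    \<comment> \<open>An infinite entropy would make the discrepancy from \<open>\<zeta>0\<close>
      infinite.\<close>
    have Hfin: "\<bar>?H P\<bar> \<noteq> \<infinity>" if "P \<in> \<Gamma>" for P
      using discrepancy_eq_infinity[OF dist assms(3) fin0] dfin that by fastforce
    \<comment> \<open>Cancelling the finite \<open>?H P\<close> leaves a bound with
      \<open>?H Ps\<close> where the saddle value has \<open>?l Ps \<zeta>s\<close>.\<close>
    have le: "?l P \<zeta>s - ?l P \<zeta>0 \<le> ?H Ps - ?l Ps \<zeta>0" if P: "P \<in> \<Gamma>" for P
      using ineq[OF P] Hfin[OF P] Hfin[OF \<open>Ps \<in> \<Gamma>\<close>] fin0[OF P] fin0[OF \<open>Ps \<in> \<Gamma>\<close>]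
      unfolding discr[OF Hfin[OF P]] discr[OF Hfin[OF \<open>Ps \<in> \<Gamma>\<close>]]
      by (cases "?l P \<zeta>s"; cases "?H Ps"; cases "?l P \<zeta>0"; cases "?l Ps \<zeta>0"; cases "?H P") auto
    have Hle: "?H Ps \<le> ?l Ps \<zeta>" if "\<zeta> \<in> acts X A L" for \<zeta>
      using gen_entropy_le_loss_Pz[OF dist that] \<open>Ps \<in> \<Gamma>\<close> by auto
    \<comment> \<open>The case \<open>P = Ps\<close> of \<open>le\<close> gives one inequality, the
      entropy bound the other.\<close>
    have eq: "?l Ps \<zeta>s = ?H Ps"
      using le[OF \<open>Ps \<in> \<Gamma>\<close>] Hle[OF assms(7)] Hfin[OF \<open>Ps \<in> \<Gamma>\<close>] fin0[OF \<open>Ps \<in> \<Gamma>\<close>]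
      by (cases "?l Ps \<zeta>s"; cases "?H Ps"; cases "?l Ps \<zeta>0") auto
    have "\<bar>?H Ps - ?l Ps \<zeta>0\<bar> \<noteq> \<infinity>"
      using Hfin[OF \<open>Ps \<in> \<Gamma>\<close>] fin0[OF \<open>Ps \<in> \<Gamma>\<close>] by auto
    then show "rel_saddle_point X A L \<Gamma> \<zeta>0 Ps \<zeta>s"
      using le Hle assms(6,7) unfolding rel_saddle_point_def rel_loss_def eq
      by (auto intro: ereal_minus_mono)
  qed
qed

end
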